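(* Let $\{\mathbf{x}^k\}$ be a sequence generated by applying the P2GP method to the problem $\min\{f(\mathbf{x}):\mathbf{x}\in\Omega\}$. Assume that the set of GP iterations, $K_{GP}$, is infinite. If some subsequence $\{\mathbf{x}^k\}_{k\in K}$, with $K\subseteq K_{GP}$ (infinite), is bounded, then $$\lim_{k\in K,\,k\to\infty}\|\nabla_\Omega f(\mathbf{x}^{k+1})\|=0.$$ Moreover, any limit point of $\{\mathbf{x}^k\}_{k\in K_{GP}}$ is a stationary point for the problem $\min\{f(\mathbf{x}):\mathbf{x}\in\Omega\}$.
   Context: Problem. $f(\mathbf{x})=\frac12\mathbf{x}^TH\mathbf{x}-\mathbf{c}^T\mathbf{x}$ with $H\in\mathbb{R}^{n\times n}$ symmetric (not necessarily positive semidefinite), $\mathbf{c},\mathbf{q}\in\mathbb{R}^n$, $b\in\mathbb{R}$; $\Omega=\{\mathbf{x}\in\mathbb{R}^n:\mathbf{q}^T\mathbf{x}=b,\ \mathbf{l}\le\mathbf{x}\le\mathbf{u}\}$ with $l_i\in\mathbb{R}\cup\{-\infty\}$, $u_i\in\mathbb{R}\cup\{+\infty\}$, $l_i<u_i$ for all $i$. $\|\cdot\|$ is the Euclidean norm, $\mathbf{e}_i$ the standard basis vectors, $P_C$ the orthogonal projection onto $C$. Index sets. $\mathcal{A}_l(\mathbf{x})=\{i:x_i=l_i\}$, $\mathcal{A}_u(\mathbf{x})=\{i:x_i=u_i\}$, $\mathcal{A}(\mathbf{x})=\mathcal{A}_l(\mathbf{x})\cup\mathcal{A}_u(\mathbf{x})$,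 $\mathcal{F}(\mathbf{x})=\{1,\dots,n\}\setminus\mathcal{A}(\mathbf{x})$; equality of active sets at two points means equality of both the lower and the upper active sets. $\Omega(\mathbf{x})=\{\mathbf{v}:\mathbf{q}^T\mathbf{v}=b,\ v_i=x_i\ \forall i\in\mathcal{A}(\mathbf{x})\}$. A subscript such as $\mathbf{q}_{\mathcal{F}}$ denotes the subvector indexed by $\mathcal{F}$. Stationarity. $\mathbf{x}^*\in\Omega$ is a stationary point if there exist $\rho^*,\lambda_i^*\in\mathbb{R}$ ($i\in\mathcal{A}(\mathbf{x}^* )$) with $\nabla f(\mathbf{x}^* )=\sum_{i\in\mathcal{A}(\mathbf{x}^* )}\lambda_i^*\mathbf{e}_i+\rho^*\mathbf{q}$, $\lambda_i^*\ge0$ for $i\in\mathcal{A}_l(\mathbf{x}^* )$, $\lambda_i^*\le0$ for $i\in\mathcal{A}_u(\mathbf{x}^* )$. Gradients. The tangent cone at $\mathbf{x}\in\Omega$ is $T_\Omega(\mathbf{x})=\{\mathbf{v}:\mathbf{q}^T\mathbf{v}=0,\ v_i\ge0\ \forall i\in\mathcal{A}_l(\mathbf{x}),\ v_i\le0\ \forall i\in\mathcal{A}_u(\mathbf{x})\}$; the projected gradient is $\nabla_\Omega f(\mathbf{x})=\operatorname{argmin}\{\|\mathbf{v}+\nabla f(\mathbf{x})\|:\mathbf{v}\in T_\Omega(\mathbf{x})\}$. With $\mathcal{F}=\mathcal{F}(\mathbf{x})$, let $\rho(\mathbf{x})=0$ if $\mathbf{q}_{\mathcal{F}}=\mathbf{0}$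 (including $\mathcal{F}=\emptyset$) and $\rho(\mathbf{x})=\mathbf{q}_{\mathcal{F}}^T\nabla f_{\mathcal{F}}(\mathbf{x})/(\mathbf{q}_{\mathcal{F}}^T\mathbf{q}_{\mathcal{F}})$ otherwise, and $\mathbf{h}(\mathbf{x})=\nabla f(\mathbf{x})-\rho(\mathbf{x})\mathbf{q}$. The free gradient $\boldsymbol{\varphi}(\mathbf{x})$ has components $\varphi_i(\mathbf{x})=h_i(\mathbf{x})$ for $i\in\mathcal{F}(\mathbf{x})$ and $0$ for $i\in\mathcal{A}(\mathbf{x})$. The chopped gradient is $\boldsymbol{\beta}(\mathbf{x})=-\nabla_\Omega f(\mathbf{x})-\boldsymbol{\varphi}(\mathbf{x})$. GP steps. Fix constants $\gamma_1,\gamma_2,\gamma_3>0$, $\mu_1,\mu_2\in(0,1)$. A GP step from $\mathbf{x}^k$ is $\mathbf{x}^{k+1}=P_\Omega(\mathbf{x}^k-\alpha^k\nabla f(\mathbf{x}^k))$ with $\alpha^k>0$ such that $f(\mathbf{x}^{k+1})\le f(\mathbf{x}^k)+\mu_1\nabla f(\mathbf{x}^k)^T(\mathbf{x}^{k+1}-\mathbf{x}^k)$, $\alpha^k\le\gamma_1$, and either $\alpha^k\ge\gamma_2$ or $\alpha^k\ge\gamma_3\bar\alpha^k>0$ for some $\bar\alpha^k$ such that, with $\mathbf{x}^k(\bar\alpha^k)=P_\Omega(\mathbf{x}^k-\bar\alpha^k\nabla f(\mathbf{x}^k))$, $f(\mathbf{x}^k(\bar\alpha^k))>f(\mathbf{x}^k)+\mu_2\nabla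 f(\mathbf{x}^k)^T(\mathbf{x}^k(\bar\alpha^k)-\mathbf{x}^k)$. P2GP method. Parameters: $\mathbf{x}^0\in\Omega$, $tol\ge0$, $\eta\in(0,1)$, $\Gamma>0$. The method stops as soon as $\|\boldsymbol{\varphi}(\mathbf{x}^k)+\boldsymbol{\beta}(\mathbf{x}^k)\|\le tol$ (convergence) or unboundedness is detected. Until then it alternates the following two phases. Identification phase, starting at iteration $m$. At each iterate $\mathbf{x}^k$: if $(\nabla_\Omega f(\mathbf{x}^k))^TH\,\nabla_\Omega f(\mathbf{x}^k)\le0$ and $\mathbf{x}^k+\alpha\nabla_\Omega f(\mathbf{x}^k)\in\Omega$ for arbitrarily large $\alpha>0$, stop with "unbounded"; otherwise perform a GP step. The phase continues as long as $\mathcal{A}(\mathbf{x}^{k+1})\ne\mathcal{A}(\mathbf{x}^k)$ and $f(\mathbf{x}^k)-f(\mathbf{x}^{k+1})>\eta\max_{m\le l<k}(f(\mathbf{x}^l)-f(\mathbf{x}^{l+1}))$ (the latter test being void when $k=m$) and the convergence test is not satisfied; otherwise the method moves to the minimization phase (if not stopped). Minimization phase. At each iterate $\mathbf{x}^k$, compute an approximate solution $\mathbf{d}^k$ (a descent direction for $f$ at $\mathbf{x}^k$ unless $\mathbf{d}^k=\mathbf{0}$) of $\min\{f(\mathbf{x}^k+\mathbf{d}):\mathbf{q}^T\mathbf{d}=0,\ d_i=0\ \forall i\in\mathcal{A}(\mathbf{x}^k)\}$. If $\mathbf{d}^k=\mathbf{0}$, return to the identification phase with the same iterate. If $\mathbf{d}^k\neq\mathbf{0}$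 and $(\mathbf{d}^k)^TH\mathbf{d}^k\le0$, let $\alpha^k$ be the largest $\alpha$ with $\mathbf{x}^k+\alpha\mathbf{d}^k\in\Omega$; if $\alpha^k=+\infty$ stop with "unbounded", otherwise set $\mathbf{x}^{k+1}=\mathbf{x}^k+\alpha^k\mathbf{d}^k$ and return to the identification phase. If $(\mathbf{d}^k)^TH\mathbf{d}^k>0$, set $\mathbf{x}^{k+1}=P_{\Omega^k}(\mathbf{x}^k+\alpha^k\mathbf{d}^k)$ with $\Omega^k=\Omega\cap\Omega(\mathbf{x}^k)$ and $\alpha^k>0$ such that $f(\mathbf{x}^{k+1})<f(\mathbf{x}^k)$, the full step $\alpha^k=1$ being taken whenever $\mathbf{x}^k+\mathbf{d}^k\in\Omega$; the minimization phase then continues from $\mathbf{x}^{k+1}$ if $\|\boldsymbol{\beta}(\mathbf{x}^{k+1})\|_\infty\le\Gamma\|\boldsymbol{\varphi}(\mathbf{x}^{k+1})\|_2$ and the convergence test fails; otherwise it ends. $K_{GP}$ (the set of GP iterations) is the set of indices $k$ such that $\mathbf{x}^{k+1}$ is generated by a GP step of the identification phase. *)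

theory Defs
  imports "HOL-Analysis.Analysis"
begin

definition grad :: "('a::real_inner \<Rightarrow> real) \<Rightarrow> 'a \<Rightarrow> 'a" where
  "grad g x = (THE D. GDERIV g x :> D)"

text \<open>
  \<^term>\<open>Identification m\<close> is the identification phase that started at iteration \<^term>\<open>m\<close>.
\<close>
datatype phase = Identification nat | Minimization

text \<open>
  Problem data \<open>H, c, q, b, l, u\<close>; GP constants \<open>\<gamma>\<^sub>1, \<gamma>\<^sub>2, \<gamma>\<^sub>3, \<mu>\<^sub>1, \<mu>\<^sub>2\<close>; method parameters
  \<open>tol, \<eta>, \<Gamma>\<close>.  Every constant defined below takes as first arguments those of these data
  that it depends on, in this order.  The bounds are extended reals: once \<open>l $ i < u $ i\<close> is
  assumed, \<open>l $ i\<close> cannot be \<open>\<infinity>\<close> and \<open>u $ i\<close> cannot be \<open>-\<infinity>\<close>.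
\<close>
context
  fixes H :: "real ^ 'n ^ 'n" and c q :: "real ^ 'n" and b :: real
    and l u :: "ereal ^ 'n"
    and \<gamma>\<^sub>1 \<gamma>\<^sub>2 \<gamma>\<^sub>3 \<mu>\<^sub>1 \<mu>\<^sub>2 :: real
    and tol \<eta> \<Gamma> :: real
begin

definition obj :: "real ^ 'n \<Rightarrow> real" where
  "obj x = (1 / 2) * (x \<bullet> (H *v x)) - c \<bullet> x"

definition feasible :: "(real ^ 'n) set" where
  "feasible = {x. q \<bullet> x = b \<and> (\<forall>i. l $ i \<le> ereal (x $ i) \<and> ereal (x $ i) \<le> u $ i)}"

definition active_lower :: "real ^ 'n \<Rightarrow> 'n set" where
  "active_lower x = {i. ereal (x $ i) = l $ i}"

definition active_upper :: "real ^ 'n \<Rightarrow> 'n set" where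
  "active_upper x = {i. ereal (x $ i) = u $ i}"

definition active :: "real ^ 'n \<Rightarrow> 'n set" where
  "active x = active_lower x \<union> active_upper x"

definition free :: "real ^ 'n \<Rightarrow> 'n set" where
  "free x = - active x"

definition same_active :: "real ^ 'n \<Rightarrow> real ^ 'n \<Rightarrow> bool" where
  "same_active x y \<longleftrightarrow> active_lower x = active_lower y \<and> active_upper x = active_upper y"

text \<open>The set \<open>\<Omega>(x)\<close>.\<close>
definition active_affine :: "real ^ 'n \<Rightarrow> (real ^ 'n) set" where
  "active_affine x = {v. q \<bullet> v = b \<and> (\<forall>i\<in>active x. v $ i = x $ i)}"

definition stationary_point :: "real ^ 'n \<Rightarrow> bool" where
  "stationary_point x \<longleftrightarrow> x \<in> feasible \<and>
     (\<exists>\<rho> lam. grad obj x = (\<Sum>i\<in>active x. lam i *\<^sub>R axis i 1) + \<rho> *\<^sub>R q \<and>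
        (\<forall>i\<in>active_lower x. lam i \<ge> 0) \<and> (\<forall>i\<in>active_upper x. lam i \<le> 0))"

definition tangent_cone :: "real ^ 'n \<Rightarrow> (real ^ 'n) set" where
  "tangent_cone x = {v. q \<bullet> v = 0 \<and> (\<forall>i\<in>active_lower x. v $ i \<ge> 0) \<and>
     (\<forall>i\<in>active_upper x. v $ i \<le> 0)}"

definition proj_grad :: "real ^ 'n \<Rightarrow> real ^ 'n" where
  "proj_grad x = arg_min_on (\<lambda>v. norm (v + grad obj x)) (tangent_cone x)"

definition rho :: "real ^ 'n \<Rightarrow> real" where
  "rho x = (if \<forall>i\<in>free x. q $ i = 0 then 0
     else (\<Sum>i\<in>free x. q $ i * grad obj x $ i) / (\<Sum>i\<in>free x. q $ i * q $ i))"

definition hvec :: "real ^ 'n \<Rightarrow> real ^ 'n" where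
  "hvec x = grad obj x - rho x *\<^sub>R q"

definition free_grad :: "real ^ 'n \<Rightarrow> real ^ 'n" where
  "free_grad x = (\<chi> i. if i \<in> free x then hvec x $ i else 0)"

definition chopped_grad :: "real ^ 'n \<Rightarrow> real ^ 'n" where
  "chopped_grad x = - proj_grad x - free_grad x"

definition gp_point :: "real ^ 'n \<Rightarrow> real \<Rightarrow> real ^ 'n" where
  "gp_point x \<alpha> = closest_point feasible (x - \<alpha> *\<^sub>R grad obj x)"

definition gp_step :: "real ^ 'n \<Rightarrow> real ^ 'n \<Rightarrow> bool" where
  "gp_step x y \<longleftrightarrow> (\<exists>\<alpha>>0. y = gp_point x \<alpha> \<and>
     obj y \<le> obj x + \<mu>\<^sub>1 * (grad obj x \<bullet> (y - x)) \<and>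
     \<alpha> \<le> \<gamma>\<^sub>1 \<and>
     (\<alpha> \<ge> \<gamma>\<^sub>2 \<or>
      (\<exists>\<alpha>'. \<alpha> \<ge> \<gamma>\<^sub>3 * \<alpha>' \<and> \<gamma>\<^sub>3 * \<alpha>' > 0 \<and>
         obj (gp_point x \<alpha>') > obj x + \<mu>\<^sub>2 * (grad obj x \<bullet> (gp_point x \<alpha>' - x)))))"

definition converged :: "real ^ 'n \<Rightarrow> bool" where
  "converged x \<longleftrightarrow> norm (free_grad x + chopped_grad x) \<le> tol"

definition unbounded_along_proj_grad :: "real ^ 'n \<Rightarrow> bool" where
  "unbounded_along_proj_grad x \<longleftrightarrow>
     proj_grad x \<bullet> (H *v proj_grad x) \<le> 0 \<and>
     (\<forall>M>0. \<exists>\<alpha>>M. x + \<alpha> *\<^sub>R proj_grad x \<in> feasible)"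

definition continue_identification :: "(nat \<Rightarrow> real ^ 'n) \<Rightarrow> nat \<Rightarrow> nat \<Rightarrow> bool" where
  "continue_identification x m k \<longleftrightarrow>
     \<not> same_active (x (Suc k)) (x k) \<and>
     (k = m \<or> obj (x k) - obj (x (Suc k)) >
        \<eta> * Max ((\<lambda>j. obj (x j) - obj (x (Suc j))) ` {m..<k}))"

definition continue_minimization :: "real ^ 'n \<Rightarrow> bool" where
  "continue_minimization y \<longleftrightarrow> infnorm (chopped_grad y) \<le> \<Gamma> * norm (free_grad y)"

definition descent_direction :: "real ^ 'n \<Rightarrow> real ^ 'n \<Rightarrow> bool" where
  "descent_direction x d \<longleftrightarrow> (\<exists>\<delta>>0. \<forall>t. 0 < t \<and> t < \<delta> \<longrightarrow> obj (x + t *\<^sub>R d) < obj x)"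

text \<open>
  The directions that may be returned as approximate solutions of the subproblem of the
  minimization phase.  No accuracy is prescribed for the approximate solution.
\<close>
definition subproblem_direction :: "real ^ 'n \<Rightarrow> real ^ 'n \<Rightarrow> bool" where
  "subproblem_direction x d \<longleftrightarrow>
     q \<bullet> d = 0 \<and> (\<forall>i\<in>active x. d $ i = 0) \<and> (d \<noteq> 0 \<longrightarrow> descent_direction x d)"

text \<open>
  \<open>P2GP_step x k p g p'\<close>: the method, being at \<open>x k\<close> in phase \<open>p\<close>, generates \<open>x (Suc k)\<close> and is
  then in phase \<open>p'\<close>; the flag \<open>g\<close> tells whether \<open>x (Suc k)\<close> is generated by a GP step.
  There is no step when unboundedness is detected (in \<open>nonpos_curvature\<close>, when no largest
  feasible \<open>\<alpha>\<close> exists).  The convergence test is in \<open>P2GP\<close> below.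
\<close>
inductive P2GP_step :: "(nat \<Rightarrow> real ^ 'n) \<Rightarrow> nat \<Rightarrow> phase \<Rightarrow> bool \<Rightarrow> phase \<Rightarrow> bool"
  for x :: "nat \<Rightarrow> real ^ 'n" and k :: nat where
  gp:
    "\<not> unbounded_along_proj_grad (x k) \<Longrightarrow> gp_step (x k) (x (Suc k)) \<Longrightarrow>
     P2GP_step x k (Identification m) True
       (if continue_identification x m k then Identification m else Minimization)"
| zero_direction:
    "subproblem_direction (x k) d \<Longrightarrow> d = 0 \<Longrightarrow>
     P2GP_step x k (Identification k) g p' \<Longrightarrow>
     P2GP_step x k Minimization g p'"
| nonpos_curvature:
    "subproblem_direction (x k) d \<Longrightarrow> d \<noteq> 0 \<Longrightarrow> d \<bullet> (H *v d) \<le> 0 \<Longrightarrow>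
     x k + \<alpha> *\<^sub>R d \<in> feasible \<Longrightarrow> (\<And>t. x k + t *\<^sub>R d \<in> feasible \<Longrightarrow> t \<le> \<alpha>) \<Longrightarrow>
     x (Suc k) = x k + \<alpha> *\<^sub>R d \<Longrightarrow>
     P2GP_step x k Minimization False (Identification (Suc k))"
| pos_curvature:
    "subproblem_direction (x k) d \<Longrightarrow> d \<bullet> (H *v d) > 0 \<Longrightarrow>
     \<alpha> > 0 \<Longrightarrow>
     x (Suc k) = closest_point (feasible \<inter> active_affine (x k)) (x k + \<alpha> *\<^sub>R d) \<Longrightarrow>
     obj (x (Suc k)) < obj (x k) \<Longrightarrow>
     (x k + d \<in> feasible \<Longrightarrow> \<alpha> = 1) \<Longrightarrow>
     P2GP_step x k Minimization False
       (if continue_minimization (x (Suc k)) then Minimization else Identification (Suc k))"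

text \<open>
  \<open>x\<close> is an infinite sequence generated by the method, that is, by a run that never stops, and
  \<open>K_GP\<close> is the set of GP iterations of that run.  Runs that stop have finitely many GP
  iterations.
\<close>
definition P2GP :: "(nat \<Rightarrow> real ^ 'n) \<Rightarrow> nat set \<Rightarrow> bool" where
  "P2GP x K_GP \<longleftrightarrow> x 0 \<in> feasible \<and>
     (\<exists>p. p 0 = Identification 0 \<and>
        (\<forall>k. \<not> converged (x k) \<and> P2GP_step x k (p k) (k \<in> K_GP) (p (Suc k))))"

end

lemma GDERIV_obj:
  assumes "transpose H = H"
  shows "GDERIV (obj H c) x :> H *v x - c"
proof -
  have sym: "v \<bullet> (H *v w) = w \<bullet> (H *v v)" for v w
    using dot_lmul_matrix[of v H w] transpose_matrix_vector[of H v] assms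
    by (simp add: inner_commute)
  have "(obj H c has_derivative (\<lambda>h. (1/2) * (x \<bullet> (H *v h) + h \<bullet> (H *v x)) - c \<bullet> h)) (at x)"
    unfolding obj_def
    by (auto intro!: derivative_eq_intros
          bounded_linear_imp_has_derivative matrix_vector_mul_bounded_linear)
  moreover have "(1/2) * (x \<bullet> (H *v h) + h \<bullet> (H *v x)) - c \<bullet> h = h \<bullet> (H *v x - c)" for h
    by (simp add: sym[of x h] inner_diff_right inner_commute)
  ultimately show ?thesis
    by (simp add: gderiv_def)
qed

lemma grad_obj:
  assumes "transpose H = H"
  shows "grad (obj H c) x = H *v x - c"
  unfolding grad_def
proof (rule the_equality)
  show G: "GDERIV (obj H c) x :> H *v x - c"
    by (rule GDERIV_obj[OF assms])
  fix D assume "GDERIV (obj H c) x :> D"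
  then have "(\<lambda>h. h \<bullet> D) = (\<lambda>h. h \<bullet> (H *v x - c))"
    using G unfolding gderiv_def by (rule has_derivative_unique)
  then show "D = H *v x - c"
    using vector_eq_ldot[of D] by (metis (no_types))
qed

end

theory Submission
  imports Defs
begin

text \<open>
  The argument rests on two facts.  First, no step of the method increases \<open>f\<close>, so one bounded
  subsequence of iterates bounds the whole sequence \<open>f(x\<^sup>k)\<close> from below and the decreases
  \<open>f(x\<^sup>k) - f(x\<^sup>k\<^sup>+\<^sup>1)\<close> tend to \<open>0\<close>.  Secondly, the step lengths of all GP iterations are at least
  some constant \<open>a > 0\<close>: a trial step \<open>t\<close> that violates sufficient decrease makes the quadratic
  term of \<open>f\<close> beat \<open>(1 - \<mu>\<^sub>2)\<close> times its linear term, and since the linear term is at least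
  \<open>\<parallel>s\<parallel>\<^sup>2 / t\<close> in absolute value (\<open>s\<close> being the displacement, and
  \<open>L\<close> a bound on the operator norm of \<open>H\<close>) while the quadratic one is at most
  \<open>L \<parallel>s\<parallel>\<^sup>2 / 2\<close>, such a \<open>t\<close> cannot be small (\<open>gp_step_length_bounded_below\<close>).

  In a GP iteration, sufficient decrease and \<open>\<alpha>\<^sup>k \<le> \<gamma>\<^sub>1\<close> bound the square of \<open>\<parallel>s\<^sup>k\<parallel>\<close>, where
  \<open>s\<^sup>k = x\<^sup>k\<^sup>+\<^sup>1 - x\<^sup>k\<close>, by a multiple of the decrease of \<open>f\<close>.  The projection inequality at
  \<open>x\<^sup>k\<^sup>+\<^sup>1\<close>, tested with directions of its tangent cone, bounds the projected gradient at \<open>x\<^sup>k\<^sup>+\<^sup>1\<close> by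
  \<open>(1 / \<alpha>\<^sup>k + L) \<parallel>s\<^sup>k\<parallel>\<close> (\<open>norm_proj_grad_gp_point_le\<close>), hence by \<open>(1 / a + L) \<parallel>s\<^sup>k\<parallel>\<close>.  This gives
  the first claim.

  For the second claim, the same projection inequality passes to the limit: at a limit point \<open>y\<close>,
  \<open>\<nabla>f(y)\<close> makes a nonnegative inner product with \<open>z - y\<close> for every feasible \<open>z\<close>, hence with
  every tangent direction, and the Farkas lemma (\<open>farkas_multipliers\<close>) turns this into multipliers.
\<close>

section \<open>The feasible set and its tangent cones\<close>

lemma closed_feasible: "closed (feasible (q::real^'n) b l u)"
proof -
  have "closed {x::real^'n. q \<bullet> x = b \<and> (\<forall>i. l $ i \<le> ereal (x $ i) \<and> ereal (x $ i) \<le> u $ i)}"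
    by (intro closed_Collect_conj closed_Collect_all closed_Collect_eq closed_Collect_le continuous_intros)
  then show ?thesis
    by (simp add: feasible_def)
qed

lemma convex_Collect_ereal_le:
  "convex {x::real^'n. l \<le> ereal (x $ i)}" "convex {x::real^'n. ereal (x $ i) \<le> u}"
proof -
  show "convex {x::real^'n. l \<le> ereal (x $ i)}"
    using convex_halfspace_ge[of "real_of_ereal l" "axis i (1::real)"]
    by (cases l) (simp_all add: inner_axis' )
  show "convex {x::real^'n. ereal (x $ i) \<le> u}"
    using convex_halfspace_le[of "axis i (1::real)" "real_of_ereal u"]
    by (cases u) (simp_all add: inner_axis' )
qed

lemma convex_feasible: "convex (feasible q b l u)"
proof -
  have "feasible q b l u =
      {x. q \<bullet> x = b} \<inter> (\<Inter>i. {x. l $ i \<le> ereal (x $ i)} \<inter> {x. ereal (x $ i) \<le> u $ i})"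
    by (auto simp: feasible_def)
  then show ?thesis
    by (auto intro!: convex_Int convex_INT convex_hyperplane convex_Collect_ereal_le)
qed

text \<open>
  The feasible set is polyhedral: an inactive bound has slack that a short step does not use up, and
  at an active bound the sign condition of the tangent cone keeps the coordinate on the right side.
  For a general convex set only the closure of the cone of feasible directions would be tangent.
\<close>
lemma tangent_cone_feasible_direction:
  assumes x: "x \<in> feasible q b l u" and v: "v \<in> tangent_cone q l u x"
  obtains t where "t > 0" "x + t *\<^sub>R v \<in> feasible q b l u"
proof -
  have lim: "((\<lambda>t. ereal (x $ i + t * v $ i)) \<longlongrightarrow> ereal (x $ i)) (at_right 0)" for i
  proof -
    have "((\<lambda>t. x $ i + t * v $ i) \<longlongrightarrow> x $ i + 0 * v $ i) (at_right 0)"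
      by (intro tendsto_intros)
    then show ?thesis by simp
  qed
  have pos: "eventually (\<lambda>t::real. t > 0) (at_right 0)"
    by (simp add: eventually_at_right_less)
  have lower: "eventually (\<lambda>t. l $ i \<le> ereal (x $ i + t * v $ i)) (at_right 0)" for i
  proof (cases "i \<in> active_lower l x")
    case True
    then have "v $ i \<ge> 0" "l $ i = ereal (x $ i)"
      using v by (auto simp: tangent_cone_def active_lower_def)
    then show ?thesis
      using pos by (auto elim!: eventually_mono)
  next
    case False
    then have "l $ i < ereal (x $ i)"
      using x by (auto simp: feasible_def active_lower_def less_le)
    from order_tendstoD(1)[OF lim this] show ?thesis
      by eventually_elim simp
  qed
  have upper: "eventually (\<lambda>t. ereal (x $ i + t * v $ i) \<le> u $ i) (at_right 0)" for i
  proof (cases "i \<in> active_upper u x")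
    case True
    then have "v $ i \<le> 0" "u $ i = ereal (x $ i)"
      using v by (auto simp: tangent_cone_def active_upper_def)
    then show ?thesis
      using pos by (auto elim!: eventually_mono simp: mult_nonneg_nonpos)
  next
    case False
    then have "ereal (x $ i) < u $ i"
      using x by (auto simp: feasible_def active_upper_def less_le)
    from order_tendstoD(2)[OF lim this] show ?thesis
      by eventually_elim simp
  qed
  have "eventually (\<lambda>t. t > 0 \<and> (\<forall>i. l $ i \<le> ereal (x $ i + t * v $ i)
      \<and> ereal (x $ i + t * v $ i) \<le> u $ i)) (at_right 0)"
    by (rule eventually_conj[OF pos eventually_all_finite[OF eventually_conj[OF lower upper]]])
  then obtain t where t: "t > 0" "\<forall>i. l $ i \<le> ereal (x $ i + t * v $ i)
      \<and> ereal (x $ i + t * v $ i) \<le> u $ i"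
    using eventually_happens'[OF trivial_limit_at_right_real] by blast
  have "q \<bullet> (x + t *\<^sub>R v) = b"
    using x v by (simp add: feasible_def tangent_cone_def inner_add_right)
  with t show ?thesis
    by (intro that[of t]) (auto simp: feasible_def)
qed

lemma tangent_cone_scaleR:
  "v \<in> tangent_cone q l u x \<Longrightarrow> t \<ge> 0 \<Longrightarrow> t *\<^sub>R v \<in> tangent_cone q l u x"
  by (auto simp: tangent_cone_def mult_nonneg_nonpos)

section \<open>The projected gradient\<close>

lemma closed_tangent_cone: "closed (tangent_cone q l u (x::real^'n))"
proof -
  have "closed {v::real^'n. q \<bullet> v = 0 \<and> (\<forall>i. i \<in> active_lower l x \<longrightarrow> v $ i \<ge> 0) \<and>
     (\<forall>i. i \<in> active_upper u x \<longrightarrow> v $ i \<le> 0)}"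
    by (intro closed_Collect_conj closed_Collect_all closed_Collect_imp closed_Collect_eq
        closed_Collect_le open_Collect_const continuous_intros)
  then show ?thesis by (simp add: tangent_cone_def Ball_def)
qed

lemma convex_tangent_cone: "convex (tangent_cone q l u x)"
  unfolding convex_def tangent_cone_def
  by (auto simp: inner_add_right intro!: add_nonneg_nonneg add_nonpos_nonpos mult_nonneg_nonpos)

text \<open>
  The projected gradient is the projection of \<open>- \<nabla>f(x)\<close> on a closed convex cone, so it exists,
  and the residual of a projection on a cone is orthogonal to the projection.
\<close>
lemma proj_grad_variational:
  shows proj_grad_in_tangent_cone: "proj_grad H c q l u x \<in> tangent_cone q l u x"
    and norm_proj_grad_squared:
      "(norm (proj_grad H c q l u x))\<^sup>2 = - (grad (obj H c) x \<bullet> proj_grad H c q l u x)"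
proof -
  let ?T = "tangent_cone q l u x" and ?g = "grad (obj H c) x" and ?p = "proj_grad H c q l u x"
  have 0: "0 \<in> ?T" by (simp add: tangent_cone_def)
  have D: "norm (v + ?g) = dist (- ?g) v" for v
    by (simp add: dist_norm norm_minus_commute add.commute norm_minus_cancel[of "v + ?g", symmetric]
        del: norm_minus_cancel)
  have "is_arg_min (\<lambda>v. norm (v + ?g)) (\<lambda>v. v \<in> ?T) (closest_point ?T (- ?g))"
    using closest_point_exists[OF closed_tangent_cone, of q l u x "- ?g"] 0
    unfolding is_arg_min_linorder D by blast
  then have "is_arg_min (\<lambda>v. norm (v + ?g)) (\<lambda>v. v \<in> ?T) ?p"
    unfolding proj_grad_def arg_min_on_def arg_min_def by (rule someI)
  then have p: "?p \<in> ?T" "\<forall>z\<in>?T. dist (- ?g) ?p \<le> dist (- ?g) z"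
    unfolding is_arg_min_linorder D by auto
  then show "?p \<in> ?T" by simp
  have dot: "(- ?g - ?p) \<bullet> (v - ?p) \<le> 0" if "v \<in> ?T" for v
    using any_closest_point_dot[OF convex_tangent_cone closed_tangent_cone p(1) that p(2)] .
  \<comment> \<open>Moving from the projection to \<open>0\<close> and to its double tests both signs of the same direction.\<close>
  from dot[OF 0] dot[OF tangent_cone_scaleR[OF p(1), of 2]]
  show "(norm ?p)\<^sup>2 = - (?g \<bullet> ?p)"
    by (simp add: power2_norm_eq_inner inner_diff_left inner_diff_right inner_simps)
qed

text \<open>
  The norm of the projected gradient is the steepest rate of descent along unit tangent directions,
  because that rate is attained at the projected gradient itself.
\<close>
lemma norm_proj_grad_le:
  assumes "\<And>v. v \<in> tangent_cone q l u x \<Longrightarrow> - (grad (obj H c) x \<bullet> v) \<le> C * norm v" and "C \<ge> 0"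
  shows "norm (proj_grad H c q l u x) \<le> C"
proof (cases "proj_grad H c q l u x = 0")
  case False
  have "norm (proj_grad H c q l u x) * norm (proj_grad H c q l u x)
      \<le> C * norm (proj_grad H c q l u x)"
    using assms(1)[OF proj_grad_in_tangent_cone] norm_proj_grad_squared[of H c q l u x]
    by (simp add: power2_eq_square)
  with False show ?thesis by simp
qed (use assms(2) in simp)

section \<open>Multipliers from the tangent cone\<close>

text \<open>
  This is the Farkas lemma for the tangent cone, which is the dual of the cone generated by
  \<open>\<plusminus>q\<close>, the unit vectors of the lower bounds and the negated unit vectors of the upper bounds.
  A finitely generated cone is closed, so a \<open>g\<close> outside it could be separated from it, and the
  normal of the separating hyperplane would be a tangent direction with negative inner product
  with \<open>g\<close>.  The strict inequality \<open>l < u\<close> excludes a coordinate at which both sign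
  conditions would force the multiplier to vanish.
\<close>
lemma farkas_multipliers:
  fixes g q :: "real ^ 'n"
  assumes lu: "\<forall>i. l $ i < u $ i"
    and g: "\<And>v. v \<in> tangent_cone q l u y \<Longrightarrow> g \<bullet> v \<ge> 0"
  shows "\<exists>\<rho> lam. g = (\<Sum>i\<in>active l u y. lam i *\<^sub>R axis i 1) + \<rho> *\<^sub>R q \<and>
     (\<forall>i\<in>active_lower l y. lam i \<ge> 0) \<and> (\<forall>i\<in>active_upper u y. lam i \<le> 0)"
proof -
  let ?A = "active l u y" and ?L = "active_lower l y" and ?U = "active_upper u y"
  define comb where "comb lam \<rho> = (\<Sum>i\<in>?A. lam i *\<^sub>R axis i 1) + \<rho> *\<^sub>R q"
    for lam :: "'n \<Rightarrow> real" and \<rho>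
  define S where "S = {comb lam \<rho> | lam \<rho>. (\<forall>i\<in>?L. lam i \<ge> 0) \<and> (\<forall>i\<in>?U. lam i \<le> 0)}"
  define G where "G = {q, - q} \<union> (\<lambda>i. axis i 1) ` ?L \<union> (\<lambda>i. - axis i 1) ` ?U"
  have disj: "?L \<inter> ?U = {}"
    using lu by (auto simp: active_lower_def active_upper_def) (metis less_irrefl)
  have S_I: "comb lam \<rho> \<in> S" if "\<forall>i\<in>?L. lam i \<ge> 0" "\<forall>i\<in>?U. lam i \<le> 0" for lam \<rho>
    using that by (auto simp: S_def)
  have add: "comb lam \<rho> + comb lam' \<rho>' = comb (\<lambda>i. lam i + lam' i) (\<rho> + \<rho>')" for lam \<rho> lam' \<rho>'
    by (simp add: comb_def algebra_simps sum.distrib)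
  have scale: "t *\<^sub>R comb lam \<rho> = comb (\<lambda>i. t * lam i) (t * \<rho>)" for t lam \<rho>
    by (simp add: comb_def algebra_simps scaleR_sum_right)
  have cone: "convex_cone S"
    unfolding convex_cone_iff
  proof (intro conjI ballI allI impI)
    have "comb (\<lambda>_. 0) 0 = 0" by (simp add: comb_def)
    with S_I[of "\<lambda>_. 0" 0] show "0 \<in> S" by simp
  next
    fix v w assume "v \<in> S" "w \<in> S"
    then obtain lam \<rho> lam' \<rho>' where
      v: "v = comb lam \<rho>" "\<forall>i\<in>?L. lam i \<ge> 0" "\<forall>i\<in>?U. lam i \<le> 0" and
      w: "w = comb lam' \<rho>'" "\<forall>i\<in>?L. lam' i \<ge> 0" "\<forall>i\<in>?U. lam' i \<le> 0"
      unfolding S_def by blast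
    show "v + w \<in> S"
      unfolding v(1) w(1) add using v(2,3) w(2,3)
      by (intro S_I) (auto intro: add_nonneg_nonneg add_nonpos_nonpos)
  next
    fix v and t :: real assume "v \<in> S" "t \<ge> 0"
    then obtain lam \<rho> where v: "v = comb lam \<rho>" "\<forall>i\<in>?L. lam i \<ge> 0" "\<forall>i\<in>?U. lam i \<le> 0"
      unfolding S_def by blast
    show "t *\<^sub>R v \<in> S"
      unfolding v(1) scale using v(2,3) \<open>t \<ge> 0\<close>
      by (intro S_I) (auto intro: mult_nonneg_nonpos)
  qed
  have gen: "G \<subseteq> S"
  proof -
    have "comb (\<lambda>_. 0) r = r *\<^sub>R q" for r
      by (simp add: comb_def)
    with S_I[of "\<lambda>_. 0" 1] S_I[of "\<lambda>_. 0" "-1"] have 1: "q \<in> S" "- q \<in> S" by auto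
    have unit: "comb (\<lambda>j. if j = i then r else 0) 0 = r *\<^sub>R axis i 1" if "i \<in> ?A" for i r
      using that by (simp add: comb_def if_distrib[of "\<lambda>t. t *\<^sub>R _"] sum.delta cong: if_cong)
    have 2: "axis i 1 \<in> S" if "i \<in> ?L" for i
    proof -
      have "comb (\<lambda>j. if j = i then 1 else 0) 0 \<in> S"
        using that disj by (intro S_I) auto
      then show ?thesis using unit[of i 1] that by (simp add: active_def)
    qed
    have 3: "- axis i 1 \<in> S" if "i \<in> ?U" for i
    proof -
      have "comb (\<lambda>j. if j = i then -1 else 0) 0 \<in> S"
        using that disj by (intro S_I) auto
      then show ?thesis using unit[of i "-1"] that by (simp add: active_def)
    qed
    from 1 2 3 show ?thesis by (auto simp: G_def)
  qed
  have "g \<in> convex_cone hull G"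
  proof (rule ccontr)
    assume notin: "g \<notin> convex_cone hull G"
    have cc: "convex_cone (convex_cone hull G)"
      by (rule convex_cone_convex_cone_hull)
    have "closed (convex_cone hull G)"
      by (rule closed_convex_cone_hull) (simp add: G_def)
    from separating_hyperplane_closed_point_inset[OF convex_convex_cone_hull this
        convex_cone_hull_nonempty notin]
    obtain a \<beta> where a: "a \<bullet> g < \<beta>" "\<And>k. k \<in> convex_cone hull G \<Longrightarrow> \<beta> < a \<bullet> k"
      by blast
    have "0 \<in> convex_cone hull G"
      by (simp add: convex_cone_hull_contains_0)
    with a(2) have \<beta>: "\<beta> < 0" by fastforce
    \<comment> \<open>If \<open>a \<bullet> k\<close> were negative, the multiple of \<open>k\<close> that lies on the separating hyperplane
        would belong to the cone.\<close>
    have nonneg: "a \<bullet> k \<ge> 0" if k: "k \<in> G" for k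
    proof (rule ccontr)
      assume "\<not> ?thesis"
      then have neg: "a \<bullet> k < 0" by simp
      have "(\<beta> / (a \<bullet> k)) *\<^sub>R k \<in> convex_cone hull G"
        using neg \<beta> by (intro convex_cone_scaleR[OF cc] hull_inc k divide_nonpos_neg) auto
      from a(2)[OF this] neg show False by simp
    qed
    have "a \<bullet> q = 0"
      using nonneg[of q] nonneg[of "- q"] by (simp add: G_def)
    moreover have "a $ i \<ge> 0" if "i \<in> ?L" for i
      using nonneg[of "axis i 1"] that by (simp add: G_def inner_axis)
    moreover have "a $ i \<le> 0" if "i \<in> ?U" for i
      using nonneg[of "- axis i 1"] that by (simp add: G_def inner_axis)
    ultimately have "a \<in> tangent_cone q l u y"
      by (simp add: tangent_cone_def inner_commute)
    from g[OF this] a(1) \<beta> show False by (simp add: inner_commute)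
  qed
  also have "\<dots> \<subseteq> S" using gen cone by (rule hull_minimal)
  finally show ?thesis
    by (auto simp: S_def comb_def)
qed

section \<open>Gradient projection steps on a quadratic\<close>

context
  fixes H :: "real ^ 'n ^ 'n" and c q :: "real ^ 'n" and b :: real and l u :: "ereal ^ 'n"
  assumes sym: "transpose H = H"
begin

lemma obj_add:
  "obj H c (x + d) = obj H c x + grad (obj H c) x \<bullet> d + (1/2) * (d \<bullet> (H *v d))"
proof -
  have "x \<bullet> (H *v d) = d \<bullet> (H *v x)"
    using dot_lmul_matrix[of x H d] transpose_matrix_vector[of H x] sym
    by (simp add: inner_commute)
  then show ?thesis
    by (simp add: obj_def grad_obj[OF sym] matrix_vector_right_distrib inner_add_left
        inner_add_right inner_diff_left inner_commute[of "H *v x" d] algebra_simps)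
qed

lemma gp_point_feasible: "x \<in> feasible q b l u \<Longrightarrow> gp_point H c q b l u x \<alpha> \<in> feasible q b l u"
  unfolding gp_point_def by (rule closest_point_in_set[OF closed_feasible]) auto

text \<open>The obtuse angle criterion for the projection that defines the GP point.\<close>
lemma gp_point_variational:
  assumes "z \<in> feasible q b l u" and y: "y = gp_point H c q b l u x \<alpha>" and "\<alpha> > 0"
  shows "grad (obj H c) x \<bullet> (y - z) \<le> (y - x) \<bullet> (z - y) / \<alpha>"
proof -
  have "(x - \<alpha> *\<^sub>R grad (obj H c) x - y) \<bullet> (z - y) \<le> 0"
    unfolding y gp_point_def
    by (rule closest_point_dot[OF convex_feasible closed_feasible assms(1)])
  then have "\<alpha> * (grad (obj H c) x \<bullet> (y - z)) \<le> (y - x) \<bullet> (z - y)"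
    by (simp add: inner_diff_left inner_diff_right algebra_simps)
  with \<open>\<alpha> > 0\<close> show ?thesis by (simp add: field_simps)
qed

lemma gp_point_descent:
  assumes "x \<in> feasible q b l u" "y = gp_point H c q b l u x \<alpha>" "\<alpha> > 0"
  shows "grad (obj H c) x \<bullet> (y - x) \<le> - ((norm (y - x))\<^sup>2 / \<alpha>)"
proof -
  have "(y - x) \<bullet> (x - y) = - (norm (y - x))\<^sup>2"
    by (simp add: power2_norm_eq_inner inner_diff_right inner_diff_left)
  with gp_point_variational[OF assms] show ?thesis by simp
qed

text \<open>
  Where sufficient decrease fails, the excess of \<open>f\<close> over its linearisation, at most
  \<open>L \<parallel>s\<parallel>\<^sup>2 / 2\<close>, exceeds \<open>(1 - \<mu>\<^sub>2) \<parallel>s\<parallel>\<^sup>2 / t\<close>; so the rejected trial steps \<open>t\<close> that the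
  accepted step is compared with are at least \<open>2 (1 - \<mu>\<^sub>2) / L\<close>.
\<close>
lemma gp_step_length_bounded_below:
  assumes L: "\<And>v. norm (H *v v) \<le> L * norm v" "L > 0"
    and x: "x \<in> feasible q b l u" and \<mu>: "\<mu>\<^sub>2 < 1" and \<gamma>: "\<gamma>\<^sub>3 > 0"
    and step: "gp_step H c q b l u \<gamma>\<^sub>1 \<gamma>\<^sub>2 \<gamma>\<^sub>3 \<mu>\<^sub>1 \<mu>\<^sub>2 x y"
  obtains \<alpha> where "\<alpha> > 0" "min \<gamma>\<^sub>2 (\<gamma>\<^sub>3 * (2 * (1 - \<mu>\<^sub>2) / L)) \<le> \<alpha>" "\<alpha> \<le> \<gamma>\<^sub>1"
    "y = gp_point H c q b l u x \<alpha>"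
    "obj H c y \<le> obj H c x + \<mu>\<^sub>1 * (grad (obj H c) x \<bullet> (y - x))"
proof -
  let ?f = "obj H c" and ?g = "grad (obj H c) x" and ?P = "gp_point H c q b l u x"
  have rejected: "2 * (1 - \<mu>\<^sub>2) / L \<le> t"
    if t: "t > 0" and big: "?f (?P t) > ?f x + \<mu>\<^sub>2 * (?g \<bullet> (?P t - x))" for t
  proof -
    define s where "s = ?P t - x"
    have "?f (?P t) = ?f x + ?g \<bullet> s + (1/2) * (s \<bullet> (H *v s))"
      using obj_add[of x s] by (simp add: s_def)
    with big have 1: "(1 - \<mu>\<^sub>2) * (- (?g \<bullet> s)) < (1/2) * (s \<bullet> (H *v s))"
      by (simp add: s_def[symmetric] algebra_simps)
    then have "s \<noteq> 0" by auto
    have "s \<bullet> (H *v s) \<le> norm s * norm (H *v s)" by (rule norm_cauchy_schwarz)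
    also have "\<dots> \<le> norm s * (L * norm s)" by (intro mult_left_mono L) simp
    finally have 2: "s \<bullet> (H *v s) \<le> L * (norm s)\<^sup>2" by (simp add: power2_eq_square algebra_simps)
    have "(norm s)\<^sup>2 / t \<le> - (?g \<bullet> s)"
      using gp_point_descent[OF x refl t] by (simp add: s_def)
    then have "(1 - \<mu>\<^sub>2) * ((norm s)\<^sup>2 / t) \<le> (1 - \<mu>\<^sub>2) * (- (?g \<bullet> s))"
      using \<mu> by (intro mult_left_mono) auto
    with 1 2 have "(1 - \<mu>\<^sub>2) * ((norm s)\<^sup>2 / t) \<le> (1/2) * (L * (norm s)\<^sup>2)" by linarith
    then have "((1 - \<mu>\<^sub>2) / t) * (norm s)\<^sup>2 \<le> (L / 2) * (norm s)\<^sup>2" by simp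
    then have "(1 - \<mu>\<^sub>2) / t \<le> L / 2"
      by (rule mult_right_le_imp_le) (simp add: \<open>s \<noteq> 0\<close>)
    then show ?thesis using t L(2) by (simp add: field_simps)
  qed
  from step obtain \<alpha> where \<alpha>: "\<alpha> > 0" "y = ?P \<alpha>" "?f y \<le> ?f x + \<mu>\<^sub>1 * (?g \<bullet> (y - x))" "\<alpha> \<le> \<gamma>\<^sub>1"
    and alt: "\<alpha> \<ge> \<gamma>\<^sub>2 \<or> (\<exists>t. \<alpha> \<ge> \<gamma>\<^sub>3 * t \<and> \<gamma>\<^sub>3 * t > 0 \<and> ?f (?P t) > ?f x + \<mu>\<^sub>2 * (?g \<bullet> (?P t - x)))"
    unfolding gp_step_def by blast
  have "min \<gamma>\<^sub>2 (\<gamma>\<^sub>3 * (2 * (1 - \<mu>\<^sub>2) / L)) \<le> \<alpha>"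
    using alt
  proof
    assume "\<exists>t. \<alpha> \<ge> \<gamma>\<^sub>3 * t \<and> \<gamma>\<^sub>3 * t > 0 \<and> ?f (?P t) > ?f x + \<mu>\<^sub>2 * (?g \<bullet> (?P t - x))"
    then obtain t where t: "\<alpha> \<ge> \<gamma>\<^sub>3 * t" "t > 0" "?f (?P t) > ?f x + \<mu>\<^sub>2 * (?g \<bullet> (?P t - x))"
      using \<gamma> by (auto simp: zero_less_mult_iff)
    have "\<gamma>\<^sub>3 * (2 * (1 - \<mu>\<^sub>2) / L) \<le> \<gamma>\<^sub>3 * t"
      using rejected[OF t(2,3)] \<gamma> by (intro mult_left_mono) auto
    with t(1) show ?thesis by linarith
  qed auto
  with \<alpha> show ?thesis by (intro that) auto
qed

text \<open>
  The projection inequality at \<open>y\<close> bounds the descent rate of \<open>\<nabla>f(x)\<close> along directions that are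
  tangent at \<open>y\<close>; replacing \<open>\<nabla>f(x)\<close> by \<open>\<nabla>f(y)\<close> costs the Lipschitz term \<open>L \<parallel>y - x\<parallel>\<close>.
  The estimate concerns the point after the step: the tangent cone at \<open>x\<close> can be larger, since
  bounds may become active along the step.
\<close>
lemma norm_proj_grad_gp_point_le:
  assumes L: "\<And>v. norm (H *v v) \<le> L * norm v" "L > 0"
    and x: "x \<in> feasible q b l u" and "\<alpha> > 0" and y: "y = gp_point H c q b l u x \<alpha>"
  shows "norm (proj_grad H c q l u y) \<le> (1 / \<alpha> + L) * norm (y - x)"
proof (rule norm_proj_grad_le)
  fix v assume v: "v \<in> tangent_cone q l u y"
  have "y \<in> feasible q b l u" using gp_point_feasible[OF x] y by simp
  from tangent_cone_feasible_direction[OF this v] obtain t where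
    t: "t > 0" "y + t *\<^sub>R v \<in> feasible q b l u" by blast
  have "t * - (grad (obj H c) x \<bullet> v) \<le> t * ((y - x) \<bullet> v / \<alpha>)"
    using gp_point_variational[OF t(2) y \<open>\<alpha> > 0\<close>] by simp
  with t(1) have "- (grad (obj H c) x \<bullet> v) \<le> (y - x) \<bullet> v / \<alpha>"
    by (simp only: mult_le_cancel_left_pos)
  also have "\<dots> \<le> norm (y - x) * norm v / \<alpha>"
    using \<open>\<alpha> > 0\<close> by (intro divide_right_mono norm_cauchy_schwarz) auto
  finally have 1: "- (grad (obj H c) x \<bullet> v) \<le> norm (y - x) * norm v / \<alpha>" .
  have "grad (obj H c) x \<bullet> v - grad (obj H c) y \<bullet> v = (H *v (x - y)) \<bullet> v"
    by (simp add: grad_obj[OF sym] matrix_vector_mult_diff_distrib inner_diff_left)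
  also have "\<dots> \<le> norm (H *v (x - y)) * norm v" by (rule norm_cauchy_schwarz)
  also have "\<dots> \<le> (L * norm (y - x)) * norm v"
    using L(1)[of "x - y"] by (intro mult_right_mono) (auto simp: norm_minus_commute)
  finally show "- (grad (obj H c) y \<bullet> v) \<le> (1 / \<alpha> + L) * norm (y - x) * norm v"
    using 1 by (simp add: algebra_simps)
qed (use assms in simp)

section \<open>Monotonicity of the method\<close>

lemma descent_direction_slope:
  assumes "descent_direction H c x d"
  shows "grad (obj H c) x \<bullet> d \<le> 0"
proof (rule ccontr)
  assume pos: "\<not> ?thesis"
  obtain \<delta> where "\<delta> > 0" and dec: "\<And>t. 0 < t \<Longrightarrow> t < \<delta> \<Longrightarrow> obj H c (x + t *\<^sub>R d) < obj H c x"
    using assms unfolding descent_direction_def by blast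
  have "((\<lambda>t. grad (obj H c) x \<bullet> d + t * ((1/2) * (d \<bullet> (H *v d)))) \<longlongrightarrow>
      grad (obj H c) x \<bullet> d + 0 * ((1/2) * (d \<bullet> (H *v d)))) (at_right 0)"
    by (intro tendsto_intros)
  from order_tendstoD(1)[OF this, of 0] pos
  have "eventually (\<lambda>t. 0 < grad (obj H c) x \<bullet> d + t * ((1/2) * (d \<bullet> (H *v d)))) (at_right 0)"
    by simp
  moreover have "eventually (\<lambda>t. t \<in> {0<..<\<delta>}) (at_right 0)"
    using \<open>\<delta> > 0\<close> by (rule eventually_at_right_real)
  ultimately have "eventually (\<lambda>t. False) (at_right (0::real))"
  proof eventually_elim
    case (elim t)
    have "0 < t * (grad (obj H c) x \<bullet> d + t * ((1/2) * (d \<bullet> (H *v d))))"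
      using elim by simp
    then show ?case
      using dec[of t] elim obj_add[of x "t *\<^sub>R d"]
      by (simp add: matrix_vector_mult_scaleR algebra_simps)
  qed
  then show False by simp
qed

lemma gp_step_decreases:
  assumes "x \<in> feasible q b l u" "\<mu>\<^sub>1 > 0" "gp_step H c q b l u \<gamma>\<^sub>1 \<gamma>\<^sub>2 \<gamma>\<^sub>3 \<mu>\<^sub>1 \<mu>\<^sub>2 x y"
  shows "y \<in> feasible q b l u" "obj H c y \<le> obj H c x"
proof -
  obtain \<alpha> where \<alpha>: "\<alpha> > 0" "y = gp_point H c q b l u x \<alpha>"
    "obj H c y \<le> obj H c x + \<mu>\<^sub>1 * (grad (obj H c) x \<bullet> (y - x))"
    using assms(3) unfolding gp_step_def by blast
  show "y \<in> feasible q b l u"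
    using gp_point_feasible[OF assms(1)] \<alpha>(2) by simp
  have "grad (obj H c) x \<bullet> (y - x) \<le> - ((norm (y - x))\<^sup>2 / \<alpha>)"
    by (rule gp_point_descent[OF assms(1) \<alpha>(2,1)])
  also have "\<dots> \<le> 0" using \<alpha>(1) by simp
  finally have "\<mu>\<^sub>1 * (grad (obj H c) x \<bullet> (y - x)) \<le> 0"
    using assms(2) by (simp add: mult_nonneg_nonpos)
  with \<alpha>(3) show "obj H c y \<le> obj H c x" by linarith
qed

text \<open>
  In the case of nonpositive curvature the step length is nonnegative because the current iterate is
  feasible, and neither the slope nor the curvature term can then increase \<open>f\<close>.
\<close>
lemma P2GP_step_decreases:
  assumes "P2GP_step H c q b l u \<gamma>\<^sub>1 \<gamma>\<^sub>2 \<gamma>\<^sub>3 \<mu>\<^sub>1 \<mu>\<^sub>2 \<eta> \<Gamma> x k p g p'"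
    and x: "x k \<in> feasible q b l u" and "\<mu>\<^sub>1 > 0"
  shows "x (Suc k) \<in> feasible q b l u \<and> obj H c (x (Suc k)) \<le> obj H c (x k)"
  using assms(1)
proof induction
  case (gp m)
  then show ?case using gp_step_decreases x \<open>\<mu>\<^sub>1 > 0\<close> by blast
next
  case (zero_direction d g p')
  then show ?case by blast
next
  case (nonpos_curvature d \<alpha>)
  have "\<alpha> \<ge> 0" using nonpos_curvature(5)[of 0] x by simp
  moreover have "grad (obj H c) (x k) \<bullet> d \<le> 0"
    using nonpos_curvature(1,2) descent_direction_slope by (auto simp: subproblem_direction_def)
  moreover have "obj H c (x (Suc k)) =
      obj H c (x k) + \<alpha> * (grad (obj H c) (x k) \<bullet> d) + (1/2) * (\<alpha> * (\<alpha> * (d \<bullet> (H *v d))))"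
    using obj_add[of "x k" "\<alpha> *\<^sub>R d"] nonpos_curvature(6)
    by (simp add: matrix_vector_mult_scaleR)
  moreover have "\<alpha> * (grad (obj H c) (x k) \<bullet> d) \<le> 0" "\<alpha> * (\<alpha> * (d \<bullet> (H *v d))) \<le> 0"
    using calculation nonpos_curvature(3) by (auto intro!: mult_nonneg_nonpos)
  ultimately show ?case using nonpos_curvature(4,6) by simp
next
  case (pos_curvature d \<alpha>)
  have "closed (active_affine q b l u (x k))"
  proof -
    have "closed {v::real^'n. q \<bullet> v = b \<and> (\<forall>i. i \<in> active l u (x k) \<longrightarrow> v $ i = x k $ i)}"
      by (intro closed_Collect_conj closed_Collect_all closed_Collect_imp closed_Collect_eq
          open_Collect_const continuous_intros)
    then show ?thesis by (simp add: active_affine_def Ball_def)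
  qed
  moreover have "x k \<in> feasible q b l u \<inter> active_affine q b l u (x k)"
    using x by (auto simp: active_affine_def feasible_def)
  ultimately have "x (Suc k) \<in> feasible q b l u \<inter> active_affine q b l u (x k)"
    unfolding pos_curvature(4)
    by (intro closest_point_in_set closed_Int closed_feasible) auto
  with pos_curvature(5) show ?case by auto
qed

end

lemma P2GP_step_is_gp_step:
  assumes "P2GP_step H c q b l u \<gamma>\<^sub>1 \<gamma>\<^sub>2 \<gamma>\<^sub>3 \<mu>\<^sub>1 \<mu>\<^sub>2 \<eta> \<Gamma> x k p g p'" and g
  shows "gp_step H c q b l u \<gamma>\<^sub>1 \<gamma>\<^sub>2 \<gamma>\<^sub>3 \<mu>\<^sub>1 \<mu>\<^sub>2 (x k) (x (Suc k))"
  using assms by induction auto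

section \<open>Convergence\<close>

lemma decseq_bounded_on_infinite_imp_diff_tendsto_0:
  fixes a :: "nat \<Rightarrow> real"
  assumes dec: "decseq a" and "infinite K" and bnd: "\<And>k. k \<in> K \<Longrightarrow> m \<le> a k"
  shows "(\<lambda>k. a k - a (Suc k)) \<longlonglongrightarrow> 0"
proof -
  have "m \<le> a k" for k
  proof -
    obtain k' where "k' \<in> K" "k \<le> k'"
      using \<open>infinite K\<close> infinite_nat_iff_unbounded_le by blast
    with bnd[of k'] decseqD[OF dec, of k k'] show ?thesis by linarith
  qed
  then obtain L where L: "a \<longlonglongrightarrow> L"
    using decseq_convergent[OF dec] by metis
  from tendsto_diff[OF L LIMSEQ_Suc[OF L]] show ?thesis by simp
qed
lemma continuous_on_obj:
  assumes "transpose H = H"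
  shows "continuous_on S (obj H c)"
proof (rule continuous_at_imp_continuous_on, intro ballI)
  fix x
  show "isCont (obj H c) x"
    using GDERIV_obj[OF assms, of c x] unfolding gderiv_def by (rule has_derivative_continuous)
qed

theorem theorem4p2:
  fixes H :: "real ^ 'n ^ 'n" and c q :: "real ^ 'n" and b :: real
    and l u :: "ereal ^ 'n"
    and \<gamma>\<^sub>1 \<gamma>\<^sub>2 \<gamma>\<^sub>3 \<mu>\<^sub>1 \<mu>\<^sub>2 tol \<eta> \<Gamma> :: real
    and x :: "nat \<Rightarrow> real ^ 'n" and K_GP :: "nat set"
  assumes "transpose H = H"
    and "\<forall>i. l $ i < u $ i"
    and "\<gamma>\<^sub>1 > 0" and "\<gamma>\<^sub>2 > 0" and "\<gamma>\<^sub>3 > 0"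
    and "0 < \<mu>\<^sub>1" and "\<mu>\<^sub>1 < 1" and "0 < \<mu>\<^sub>2" and "\<mu>\<^sub>2 < 1"
    and "tol \<ge> 0" and "0 < \<eta>" and "\<eta> < 1" and "\<Gamma> > 0"
    and "P2GP H c q b l u \<gamma>\<^sub>1 \<gamma>\<^sub>2 \<gamma>\<^sub>3 \<mu>\<^sub>1 \<mu>\<^sub>2 tol \<eta> \<Gamma> x K_GP"
    and "infinite K_GP"
  shows "(\<forall>K. K \<subseteq> K_GP \<and> infinite K \<and> bounded (x ` K) \<longrightarrow>
            ((\<lambda>k. norm (proj_grad H c q l u (x (Suc k)))) \<longlongrightarrow> 0)
              (inf sequentially (principal K))) \<and>
         (\<forall>y. (\<exists>r. strict_mono r \<and> range r \<subseteq> K_GP \<and> (x \<circ> r) \<longlonglongrightarrow> y) \<longrightarrow>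
            stationary_point H c q b l u y)"
proof -
  note sym = assms(1)
  let ?\<Omega> = "feasible q b l u" and ?f = "obj H c" and ?g = "grad (obj H c)"
  let ?s = "\<lambda>k. x (Suc k) - x k" and ?pg = "proj_grad H c q l u"
  from assms(14) obtain p where x0: "x 0 \<in> ?\<Omega>"
    and run: "\<And>k. P2GP_step H c q b l u \<gamma>\<^sub>1 \<gamma>\<^sub>2 \<gamma>\<^sub>3 \<mu>\<^sub>1 \<mu>\<^sub>2 \<eta> \<Gamma> x k (p k) (k \<in> K_GP) (p (Suc k))"
    unfolding P2GP_def by blast
  have feas: "x k \<in> ?\<Omega>" for k
    by (induction k) (use x0 P2GP_step_decreases[OF sym run _ assms(6)] in auto)
  have dec: "decseq (\<lambda>k. ?f (x k))"
    using P2GP_step_decreases[OF sym run feas assms(6)] by (intro decseq_SucI) auto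
  obtain L where L: "L > 0" "\<And>v. norm (H *v v) \<le> L * norm v"
    using bounded_linear.pos_bounded[OF matrix_vector_mul_bounded_linear[of H]]
    by (auto simp: mult.commute)
  define a where "a = min \<gamma>\<^sub>2 (\<gamma>\<^sub>3 * (2 * (1 - \<mu>\<^sub>2) / L))"
  have "a > 0" using assms L(1) by (simp add: a_def)
  \<comment> \<open>All that the limit arguments need from a GP iteration, with constants independent of \<open>k\<close>.\<close>
  have gp: "(norm (?s k))\<^sup>2 \<le> (\<gamma>\<^sub>1 / \<mu>\<^sub>1) * (?f (x k) - ?f (x (Suc k)))"
    "norm (?pg (x (Suc k))) \<le> (1 / a + L) * norm (?s k)"
    "\<And>z. z \<in> ?\<Omega> \<Longrightarrow> ?g (x k) \<bullet> (x (Suc k) - z) \<le> norm (?s k) * norm (z - x (Suc k)) / a"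
    if "k \<in> K_GP" for k
  proof -
    have "gp_step H c q b l u \<gamma>\<^sub>1 \<gamma>\<^sub>2 \<gamma>\<^sub>3 \<mu>\<^sub>1 \<mu>\<^sub>2 (x k) (x (Suc k))"
      using P2GP_step_is_gp_step[OF run that] .
    from gp_step_length_bounded_below[OF sym L(2,1) feas assms(9,5) this]
    obtain \<alpha> where \<alpha>: "\<alpha> > 0" "a \<le> \<alpha>" "\<alpha> \<le> \<gamma>\<^sub>1" "x (Suc k) = gp_point H c q b l u (x k) \<alpha>"
      and suff: "?f (x (Suc k)) \<le> ?f (x k) + \<mu>\<^sub>1 * (?g (x k) \<bullet> ?s k)"
      unfolding a_def by blast
    have "(norm (?s k))\<^sup>2 / \<gamma>\<^sub>1 \<le> (norm (?s k))\<^sup>2 / \<alpha>"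
      using \<alpha> by (intro divide_left_mono) auto
    also have "\<dots> \<le> - (?g (x k) \<bullet> ?s k)"
      using gp_point_descent[OF sym feas \<alpha>(4,1)] by simp
    finally have "\<mu>\<^sub>1 * ((norm (?s k))\<^sup>2 / \<gamma>\<^sub>1) \<le> \<mu>\<^sub>1 * - (?g (x k) \<bullet> ?s k)"
      using assms(6) by (intro mult_left_mono) auto
    with suff have "\<mu>\<^sub>1 * ((norm (?s k))\<^sup>2 / \<gamma>\<^sub>1) \<le> ?f (x k) - ?f (x (Suc k))" by simp
    then show "(norm (?s k))\<^sup>2 \<le> (\<gamma>\<^sub>1 / \<mu>\<^sub>1) * (?f (x k) - ?f (x (Suc k)))"
      using assms(3,6) by (simp add: field_simps)
    have "norm (?pg (x (Suc k))) \<le> (1 / \<alpha> + L) * norm (?s k)"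
      by (rule norm_proj_grad_gp_point_le[OF sym L(2,1) feas \<alpha>(1,4)])
    also have "\<dots> \<le> (1 / a + L) * norm (?s k)"
      using \<open>a > 0\<close> \<alpha>(2) by (intro mult_right_mono add_right_mono divide_left_mono) auto
    finally show "norm (?pg (x (Suc k))) \<le> (1 / a + L) * norm (?s k)" .
    fix z assume z: "z \<in> ?\<Omega>"
    have "?g (x k) \<bullet> (x (Suc k) - z) \<le> ?s k \<bullet> (z - x (Suc k)) / \<alpha>"
      by (rule gp_point_variational[OF sym z \<alpha>(4,1)])
    also have "\<dots> \<le> norm (?s k) * norm (z - x (Suc k)) / \<alpha>"
      using \<alpha>(1) by (intro divide_right_mono norm_cauchy_schwarz) auto
    also have "\<dots> \<le> norm (?s k) * norm (z - x (Suc k)) / a"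
      using \<open>a > 0\<close> \<alpha>(2) by (intro divide_left_mono) auto
    finally show "?g (x k) \<bullet> (x (Suc k) - z) \<le> norm (?s k) * norm (z - x (Suc k)) / a" .
  qed
  have step_to_0: "((\<lambda>k. norm (?s k)) \<longlongrightarrow> 0) (inf sequentially (principal K))"
    if K: "K \<subseteq> K_GP" "infinite K" "bounded (x ` K)" for K
  proof -
    have "compact (closure (x ` K))" using K(3) by simp
    then have "bounded (?f ` closure (x ` K))"
      by (intro compact_imp_bounded compact_continuous_image continuous_on_obj[OF sym])
    then obtain m where m: "\<And>v. v \<in> closure (x ` K) \<Longrightarrow> \<bar>?f v\<bar> \<le> m"
      by (auto simp: bounded_real)
    have "- m \<le> ?f (x k)" if "k \<in> K" for k
      using m[of "x k"] that closure_subset[of "x ` K"] by fastforce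
    from decseq_bounded_on_infinite_imp_diff_tendsto_0[OF dec K(2) this]
    have "(\<lambda>k. ?f (x k) - ?f (x (Suc k))) \<longlonglongrightarrow> 0" .
    from tendsto_mult_right_zero[OF this, of "\<gamma>\<^sub>1 / \<mu>\<^sub>1"]
    have "(\<lambda>k. (\<gamma>\<^sub>1 / \<mu>\<^sub>1) * (?f (x k) - ?f (x (Suc k)))) \<longlonglongrightarrow> 0" .
    then have "((\<lambda>k. (\<gamma>\<^sub>1 / \<mu>\<^sub>1) * (?f (x k) - ?f (x (Suc k)))) \<longlongrightarrow> 0) (inf sequentially (principal K))"
      by (rule tendsto_mono[rotated]) simp
    moreover have ev: "\<forall>\<^sub>F k in inf sequentially (principal K).
        (norm (?s k))\<^sup>2 \<le> (\<gamma>\<^sub>1 / \<mu>\<^sub>1) * (?f (x k) - ?f (x (Suc k)))"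
      using gp(1) K(1) by (auto simp: eventually_inf_principal intro!: always_eventually)
    ultimately have "((\<lambda>k. (norm (?s k))\<^sup>2) \<longlongrightarrow> 0) (inf sequentially (principal K))"
      using tendsto_sandwich[OF _ ev tendsto_const, of 0] by simp
    from tendsto_real_sqrt[OF this] show ?thesis by simp
  qed
  show ?thesis
  proof (intro conjI allI impI; (elim conjE exE)?)
    fix K assume K: "K \<subseteq> K_GP" "infinite K" "bounded (x ` K)"
    have ev: "\<forall>\<^sub>F k in inf sequentially (principal K).
        norm (?pg (x (Suc k))) \<le> (1 / a + L) * norm (?s k)"
      using gp(2) K(1) by (auto simp: eventually_inf_principal intro!: always_eventually)
    have "((\<lambda>k. (1 / a + L) * norm (?s k)) \<longlongrightarrow> 0) (inf sequentially (principal K))"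
      by (rule tendsto_mult_right_zero[OF step_to_0[OF K]])
    then
    show "((\<lambda>k. norm (?pg (x (Suc k)))) \<longlongrightarrow> 0) (inf sequentially (principal K))"
      using tendsto_sandwich[OF _ ev tendsto_const, of 0] by simp
  next
    fix y r assume r: "strict_mono (r :: nat \<Rightarrow> nat)" "range r \<subseteq> K_GP" and lim: "(x \<circ> r) \<longlonglongrightarrow> y"
    have "infinite (range r)"
      using r(1) by (simp add: range_inj_infinite strict_mono_imp_inj_on)
    moreover have "bounded (x ` range r)"
      using convergent_imp_bounded[OF lim] by (simp add: image_comp)
    moreover have "filterlim r (inf sequentially (principal (range r))) sequentially"
      using filterlim_subseq[OF r(1)] by (simp add: filterlim_inf filterlim_principal)
    ultimately have s0: "(\<lambda>j. norm (?s (r j))) \<longlonglongrightarrow> 0"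
      using filterlim_compose[OF step_to_0[OF r(2)]] by blast
    from tendsto_add[OF lim tendsto_norm_zero_cancel[OF this]]
    have lim_Suc: "(\<lambda>j. x (Suc (r j))) \<longlonglongrightarrow> y" by simp
    have lim_g: "(\<lambda>j. ?g (x (r j))) \<longlonglongrightarrow> ?g y"
      using lim unfolding grad_obj[OF sym] o_def
      by (intro tendsto_intros bounded_linear.tendsto[OF matrix_vector_mul_bounded_linear])
    have y: "y \<in> ?\<Omega>"
      using closed_sequentially[OF closed_feasible _ lim] feas by simp
    have var: "?g y \<bullet> (y - z) \<le> 0" if z: "z \<in> ?\<Omega>" for z
    proof (rule LIMSEQ_le)
      show "(\<lambda>j. ?g (x (r j)) \<bullet> (x (Suc (r j)) - z)) \<longlonglongrightarrow> ?g y \<bullet> (y - z)"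
        by (intro tendsto_intros lim_g lim_Suc)
      have "(\<lambda>j. norm (?s (r j)) * norm (z - x (Suc (r j))) / a) \<longlonglongrightarrow> 0 * norm (z - y) / a"
        using \<open>a > 0\<close> by (intro tendsto_intros s0 lim_Suc) auto
      then show "(\<lambda>j. norm (?s (r j)) * norm (z - x (Suc (r j))) / a) \<longlonglongrightarrow> 0" by simp
      show "\<exists>N. \<forall>j\<ge>N. ?g (x (r j)) \<bullet> (x (Suc (r j)) - z)
          \<le> norm (?s (r j)) * norm (z - x (Suc (r j))) / a"
        using gp(3)[OF _ z] r(2) by blast
    qed
    have "?g y \<bullet> v \<ge> 0" if v: "v \<in> tangent_cone q l u y" for v
    proof -
      obtain t where t: "t > 0" "y + t *\<^sub>R v \<in> ?\<Omega>"
        using tangent_cone_feasible_direction[OF y v] by blast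
      then show ?thesis using var[OF t(2)] by (simp add: zero_le_mult_iff)
    qed
    from farkas_multipliers[OF assms(2) this] y
    show "stationary_point H c q b l u y" unfolding stationary_point_def by blast
  qed
qed

end
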